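(* Let $G=(A\cup B,E)$ be a marriage instance with critical set $C\subseteq A$, and let $G''$ be the instance constructed from $G$ as described in the context. In any stable matching $M''$ of $G''$, for every $m\in A$, at most one copy of $m$ is matched to a non-dummy woman (a woman of $B$).
   Context: A marriage instance is a bipartite graph $G=(A\cup B,E)$ ($A$ men, $B$ women) with strict preference lists; $\mathrm{Pref}(v)$ denotes the list of $v$; every vertex prefers being matched to being unmatched. A matching is stable if no edge $(a,b)$ outside it has both endpoints preferring each other to their current partners. Construction of $G''=(A''\cup B'',E'')$: let $\ell=|C|$. For $m\in C$, $A''$ contains copies $m^0,\dots,m^{\ell+1}$ and $B''$ contains dummies $d_m^1,\dots,d_m^{\ell+1}$. For $m\in A\setminus C$, $A''$ contains copies $m^0,m^1$ and $B''$ contains one dummy $d_m^1$. $B''$ also contains all of $B$. Preferences: for $m\in A\setminus C$: $m^0$: $\mathrm{Pref}(m)$ followed by $d_m^1$; $m^1$: $d_m^1$ followed by $\mathrm{Pref}(m)$. For $m\in C$: $m^0$: $\mathrm{Pref}(m)$ followed by $d_m^1$; $m^i$ ($1\le i\le \ell$): $d_m^i$, then $\mathrm{Pref}(m)$, then $d_m^{i+1}$; $m^{\ell+1}$: $d_m^{\ell+1}$ followed by $\mathrm{Pref}(m)$. For $w\in B$: the existing level-$(\ell+1)$ copies of the men of $\mathrm{Pref}(w)$ in the order of $\mathrm{Pref}(w)$, then the level-$\ell$ copies, and so on down to the level-$0$ copies. For a dummy $d_m^i$: $m^{i-1}$ then $m^i$. *)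

theory Defs
  imports Main
begin

(* Men and women live in separate types, so the two sides of the graph are disjoint
   and an edge is a pair (man, woman). *)

record ('m, 'w) instance_data =
  men :: "'m set"
  women :: "'w set"
  edges :: "('m \<times> 'w) set"
  pref_man :: "'m \<Rightarrow> 'w list"
  pref_woman :: "'w \<Rightarrow> 'm list"

definition marriage_instance :: "('m, 'w) instance_data \<Rightarrow> bool" where
  "marriage_instance G \<longleftrightarrow>
     finite (men G) \<and> finite (women G) \<and> edges G \<subseteq> men G \<times> women G \<and>
     (\<forall>a \<in> men G. distinct (pref_man G a) \<and> set (pref_man G a) = {b. (a, b) \<in> edges G}) \<and>
     (\<forall>b \<in> women G. distinct (pref_woman G b) \<and> set (pref_woman G b) = {a. (a, b) \<in> edges G})"

definition precedes :: "'a list \<Rightarrow> 'a \<Rightarrow> 'a \<Rightarrow> bool" where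
  "precedes xs x y \<longleftrightarrow> (\<exists>i j. i < j \<and> j < length xs \<and> xs ! i = x \<and> xs ! j = y)"

definition is_matching :: "('m, 'w) instance_data \<Rightarrow> ('m \<times> 'w) set \<Rightarrow> bool" where
  "is_matching G M \<longleftrightarrow>
     M \<subseteq> edges G \<and>
     (\<forall>a b b'. (a, b) \<in> M \<longrightarrow> (a, b') \<in> M \<longrightarrow> b = b') \<and>
     (\<forall>a a' b. (a, b) \<in> M \<longrightarrow> (a', b) \<in> M \<longrightarrow> a = a')"

(* An unmatched vertex satisfies its conjunct vacuously: it prefers every neighbour to
   being unmatched. *)

definition blocks :: "('m, 'w) instance_data \<Rightarrow> ('m \<times> 'w) set \<Rightarrow> 'm \<Rightarrow> 'w \<Rightarrow> bool" where
  "blocks G M a b \<longleftrightarrow>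
     (a, b) \<in> edges G - M \<and>
     (\<forall>b'. (a, b') \<in> M \<longrightarrow> precedes (pref_man G a) b b') \<and>
     (\<forall>a'. (a', b) \<in> M \<longrightarrow> precedes (pref_woman G b) a a')"

definition stable_matching :: "('m, 'w) instance_data \<Rightarrow> ('m \<times> 'w) set \<Rightarrow> bool" where
  "stable_matching G M \<longleftrightarrow> is_matching G M \<and> (\<nexists>a b. blocks G M a b)"

(* Copy m i is the level-i copy of m, and Dummy m i is the i-th dummy woman of m. *)

datatype 'm man_copy = Copy 'm nat

datatype ('m, 'w) ext_woman = Woman 'w | Dummy 'm nat

(* The highest level of a copy of m, which is also the number of dummies of m. *)

definition top_level :: "'m set \<Rightarrow> 'm \<Rightarrow> nat" where
  "top_level C m = (if m \<in> C then card C + 1 else 1)"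

(* Level 0 has no dummy in front of Pref(m) and the top level has none behind it; for m
   outside C these are the only two levels. *)

fun copy_pref ::
  "('m, 'w) instance_data \<Rightarrow> 'm set \<Rightarrow> 'm man_copy \<Rightarrow> ('m, 'w) ext_woman list" where
  "copy_pref G C (Copy m i) =
     (if i = 0 then [] else [Dummy m i]) @
     map Woman (pref_man G m) @
     (if i < top_level C m then [Dummy m (i + 1)] else [])"

fun ext_woman_pref ::
  "('m, 'w) instance_data \<Rightarrow> 'm set \<Rightarrow> ('m, 'w) ext_woman \<Rightarrow> 'm man_copy list" where
  "ext_woman_pref G C (Woman w) =
     concat (map (\<lambda>i. map (\<lambda>m. Copy m i) (filter (\<lambda>m. i \<le> top_level C m) (pref_woman G w)))
       (rev [0..<card C + 2]))"
| "ext_woman_pref G C (Dummy m i) = [Copy m (i - 1), Copy m i]"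

definition copies :: "('m, 'w) instance_data \<Rightarrow> 'm set \<Rightarrow> 'm man_copy set" where
  "copies G C = {Copy m i | m i. m \<in> men G \<and> i \<le> top_level C m}"

definition ext_women :: "('m, 'w) instance_data \<Rightarrow> 'm set \<Rightarrow> ('m, 'w) ext_woman set" where
  "ext_women G C =
     Woman ` women G \<union> {Dummy m i | m i. m \<in> men G \<and> 1 \<le> i \<and> i \<le> top_level C m}"

(* The instance G'' of the construction; its edges are those given by the preference lists. *)

definition ext_instance ::
  "('m, 'w) instance_data \<Rightarrow> 'm set \<Rightarrow> ('m man_copy, ('m, 'w) ext_woman) instance_data" where
  "ext_instance G C =
     \<lparr>men = copies G C,
      women = ext_women G C,
      edges = {(a, b). a \<in> copies G C \<and> b \<in> set (copy_pref G C a)},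
      pref_man = copy_pref G C,
      pref_woman = ext_woman_pref G C\<rparr>"

(* The lists of the men and of the women induce the same edges. *)

lemma marriage_instance_ext_instance:
  assumes G: "marriage_instance G" and C: "C \<subseteq> men G"
  shows "marriage_instance (ext_instance G C)"
proof -
  have top: "top_level C m \<le> card C + 1" for m
    by (simp add: top_level_def)
  have "copies G C \<subseteq> (\<lambda>(m, i). Copy m i) ` (men G \<times> {..card C + 1})"
    using top by (fastforce simp: copies_def intro: order_trans)
  moreover have "ext_women G C \<subseteq>
      Woman ` women G \<union> (\<lambda>(m, i). Dummy m i) ` (men G \<times> {..card C + 1})"
    using top by (fastforce simp: ext_women_def intro: order_trans)
  moreover have "finite (men G)" "finite (women G)"
    using G by (auto simp: marriage_instance_def)
  ultimately have fin: "finite (copies G C)" "finite (ext_women G C)"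
    by (meson finite_SigmaI finite_UnI finite_atMost finite_imageI finite_subset)+
  have sub: "edges (ext_instance G C) \<subseteq> copies G C \<times> ext_women G C"
    using G by (fastforce simp: ext_instance_def copies_def ext_women_def marriage_instance_def
        split: if_splits)
  have man: "distinct (copy_pref G C a)" if "a \<in> copies G C" for a
    using that G by (auto simp: copies_def marriage_instance_def distinct_map inj_on_def)
  have dist_levels: "distinct (concat (map (\<lambda>i. map (\<lambda>m. Copy m i) (filter (P i) xs)) ls))"
    if "distinct xs" "distinct ls" for P and xs :: "'a list" and ls
    using that(2) by (induction ls) (use that(1) in \<open>auto simp: distinct_map inj_on_def\<close>)
  have woman: "distinct (ext_woman_pref G C b)" if "b \<in> ext_women G C" for b
    using that G
    by (auto simp: ext_women_def marriage_instance_def simp del: distinct_concat_iff upt_Suc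
        intro!: dist_levels)
  have nbr: "set (ext_woman_pref G C b) = {a. (a, b) \<in> edges (ext_instance G C)}"
    if b: "b \<in> ext_women G C" for b
  proof (cases b)
    case (Woman w)
    then have w: "w \<in> women G"
      using b by (auto simp: ext_women_def)
    have "Copy m i \<in> set (ext_woman_pref G C b) \<longleftrightarrow> (Copy m i, b) \<in> edges (ext_instance G C)"
      for m i
    proof -
      have "Copy m i \<in> set (ext_woman_pref G C b) \<longleftrightarrow>
          i \<le> top_level C m \<and> m \<in> set (pref_woman G w)"
        using top[of m] Woman by (auto simp del: upt_Suc simp: image_iff)
      then show ?thesis
        using G w Woman by (auto simp: ext_instance_def copies_def marriage_instance_def)
    qed
    then show ?thesis
      by (metis (no_types, lifting) man_copy.exhaust mem_Collect_eq subsetI subset_antisym)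
  next
    case (Dummy m i)
    then show ?thesis
      using b by (auto simp: ext_women_def ext_instance_def copies_def split: if_splits)
  qed
  show ?thesis
    using fin sub man woman nbr unfolding marriage_instance_def
    by (auto simp: ext_instance_def)
qed

end

(* A copy of m at a level j + 1 that is not matched to its own dummy prefers that dummy to its
   partner, so by stability the dummy is matched to the only man it likes better, the copy at
   level j. That copy is then itself not matched to its own dummy, and the argument descends to
   level 0. So all levels below a copy matched to a woman of B are matched to dummies. *)

theory Submission
  imports Defs
begin

lemma precedes_Cons: "y \<in> set xs \<Longrightarrow> precedes (x # xs) x y"
  unfolding precedes_def by (metis in_set_conv_nth length_Cons not_less_eq nth_Cons_0 nth_Cons_Suc zero_less_Suc)

lemma stable_dummy_matched_below:
  assumes stable: "stable_matching (ext_instance G C) M"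
    and matched: "(Copy m (Suc j), b) \<in> M" and other: "b \<noteq> Dummy m (Suc j)"
  shows "(Copy m j, Dummy m (Suc j)) \<in> M"
proof (rule ccontr)
  assume below: "(Copy m j, Dummy m (Suc j)) \<notin> M"
  let ?G = "ext_instance G C" and ?a = "Copy m (Suc j)" and ?d = "Dummy m (Suc j)"
  have sub: "M \<subseteq> edges ?G" and uniq: "\<And>b'. (?a, b') \<in> M \<Longrightarrow> b' = b"
    using stable matched unfolding stable_matching_def is_matching_def by blast+
  have a: "?a \<in> copies G C" and b: "b \<in> set (copy_pref G C ?a)"
    using sub matched by (auto simp: ext_instance_def)
  have "(?a, ?d) \<in> edges ?G - M"
    using a other uniq by (auto simp: ext_instance_def)
  \<comment> \<open>The level \<open>Suc j\<close> is nonzero, so \<open>?d\<close> heads the list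
    of \<open>?a\<close>.\<close>
  moreover have "precedes (pref_man ?G ?a) ?d b"
    using b other by (auto simp: ext_instance_def intro!: precedes_Cons)
  \<comment> \<open>Only the copies at levels \<open>j\<close> and \<open>Suc j\<close> list
    \<open>?d\<close>, and neither is matched to it. So \<open>?d\<close> is unmatched and its
    condition in \<open>blocks\<close> is vacuous.\<close>
  moreover have "(a', ?d) \<notin> M" for a'
  proof
    assume a': "(a', ?d) \<in> M"
    then have "?d \<in> set (copy_pref G C a')"
      using sub by (auto simp: ext_instance_def)
    then have "a' = Copy m j \<or> a' = ?a"
      by (cases a') (auto split: if_splits)
    then show False
      using a' below other uniq by auto
  qed
  ultimately have "blocks ?G M ?a ?d"
    using uniq unfolding blocks_def by blast
  then show False
    using stable unfolding stable_matching_def by blast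
qed

text \<open>Allowing \<open>b\<close> to be a dummy other than \<open>Dummy m j\<close> lets the
  induction continue: the next copy down is matched to the dummy one index above its own
  level.\<close>

lemma stable_copies_below_matched_to_dummies:
  assumes stable: "stable_matching (ext_instance G C) M"
    and "(Copy m j, b) \<in> M" and "b \<noteq> Dummy m j" and "i < j"
  shows "(Copy m i, Dummy m (Suc i)) \<in> M"
  using assms(2-)
proof (induction j arbitrary: b)
  case (Suc j)
  have "(Copy m j, Dummy m (Suc j)) \<in> M"
    using stable_dummy_matched_below[OF stable] Suc.prems by blast
  then show ?case
    using Suc.IH Suc.prems by (cases "i = j") auto
qed simp

theorem mainTheorem11:
  fixes G :: "('m, 'w) instance_data"
    and C :: "'m set"
    and M :: "('m man_copy \<times> ('m, 'w) ext_woman) set"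
  assumes "marriage_instance G"
    and "C \<subseteq> men G"
    and "stable_matching (ext_instance G C) M"
    and "m \<in> men G"
  shows "\<exists>\<^sub>\<le>\<^sub>1 i. \<exists>w \<in> women G. (Copy m i, Woman w) \<in> M"
proof -
  have "\<not> i < j" if "(Copy m i, Woman v) \<in> M" "(Copy m j, Woman w) \<in> M" for i j v w
  proof
    assume "i < j"
    then have "(Copy m i, Dummy m (Suc i)) \<in> M"
      using stable_copies_below_matched_to_dummies[OF assms(3) that(2)] by simp
    \<comment> \<open>\<open>Copy m i\<close> would have two partners, a dummy and
      \<open>Woman v\<close>.\<close>
    then show False
      using that(1) assms(3) unfolding stable_matching_def is_matching_def by blast
  qed
  then show ?thesis
    unfolding Uniq_def by (meson linorder_neqE_nat)
qed

end
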